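(* Let $N\ge 1$ and let $E:\mathbb{R}^N\to\mathbb{R}$ be strictly convex and twice continuously differentiable, with positive definite Hessian $W(x):=\partial_x^2E(x)$ at every $x\in\mathbb{R}^N$. Let $\Delta:\mathbb{R}^N\to(0,\infty)$ be a function and put $$\mathbb{U}(x):=\{u\in\mathbb{R}^N:\ \langle u, W(x)u\rangle\le\Delta(x)\}.$$ Let $$V^\infty(\lambda):=\|\lambda\|_\infty=\max_{1\le i\le N}|\lambda^i|,\qquad \lambda=(\lambda^1,\dots,\lambda^N)\in\mathbb{R}^N .$$ Then the maximum principle with $V=V^\infty$ generates the normalized coordinate descent algorithm, in the following sense. Let $\nu_0>0$, let $(h_k)_{k\ge 0}$ be positive reals, and let $(x_k)_{k\ge0}$ in $\mathbb{R}^N$ satisfy $x_{k+1}=x_k+h_ku_k$, where, for each $k$ with $\partial_xE(x_k)\neq 0$, $u_k$ is a solution of $$\text{Maximize}_{u\in\mathbb{U}(x_k)}\ \langle \xi_k,\ \partial_x^2E(x_k)\,u\rangle ,$$ with $\lambda_k:=-\nu_0\,\partial_xE(x_k)$ and $\xi_k\in\partial V^\infty(\lambda_k)$ the unbiased subgradient of $V^\infty$ at $\lambda_k$. Then for every $k$ with $\partial_xE(x_k)\neq0$ there is a step size $\alpha_k>0$ such that $$x_{k+1}=x_k-\alpha_k\, q\circ\mathrm{sign}\big(\partial_xE(x_k)\big),$$ where $q=q(\lambda_k)$.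
   Context: $\partial_xE$ and $\partial_x^2E$ denote the gradient and Hessian of $E$; $\langle\cdot,\cdot\rangle$ is the Euclidean inner product, $\circ$ is the Hadamard (componentwise) product of vectors, and $\mathrm{sign}$ is applied componentwise (with $\mathrm{sign}(0)=0$; this convention plays no role when $\lambda\ne0$, since then $q$ vanishes at zero components). For $\lambda\in\mathbb{R}^N$, the vector $q(\lambda)\in\{0,1\}^N$ is defined by $q^i=1$ if $|\lambda^i|=\max_j|\lambda^j|$ and $q^i=0$ otherwise. $\partial V^\infty(\lambda)$ is the (convex) subdifferential of $V^\infty$ at $\lambda$; explicitly, for $\lambda\neq0$ it is the convex hull of the vectors $\mathrm{sign}(\lambda^i)e_i$ over those $i$ with $|\lambda^i|=\|\lambda\|_\infty$, where $e_i$ is the $i$-th standard basis vector. The unbiased subgradient of $V^\infty$ at $\lambda\ne0$ is the vector $\gamma\,q(\lambda)\circ\mathrm{sign}(\lambda)$, where $\gamma>0$ is chosen so that this vector lies in $\partial V^\infty(\lambda)$. Background meaning of the maximum principle: to minimize $E$ one considers a trajectory $\dot x=u$ with costate $\lambda=-\nu_0\,\partial_xE(x)$, $\nu_0>0$, so that $\dot\lambda=-\nu_0\,\partial_x^2E(x)u$. Given a positive definite function $V$ of $\lambda$ (a candidate control Lyapunov function) and a compact control set $\mathbb{U}$, the maximum principle selects the control $u\in\mathbb{U}$ maximizing $\langle\xi,\partial_x^2E(x)u\rangle$ for a subgradient $\xi\in\partial V(\lambda)$. The algorithm is the forward Euler discretization $x_{k+1}=x_k+h_ku_k$, $h_k>0$.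 *)

theory Defs
  imports "HOL-Analysis.Analysis"
begin

definition strictly_convex_on :: "'a::real_vector set \<Rightarrow> ('a \<Rightarrow> real) \<Rightarrow> bool" where
  "strictly_convex_on S f \<longleftrightarrow> convex S \<and>
    (\<forall>x\<in>S. \<forall>y\<in>S. x \<noteq> y \<longrightarrow>
      (\<forall>u>0. \<forall>v>0. u + v = 1 \<longrightarrow> f (u *\<^sub>R x + v *\<^sub>R y) < u * f x + v * f y))"

definition gradient :: "('a::real_inner \<Rightarrow> real) \<Rightarrow> 'a \<Rightarrow> 'a" where
  "gradient f x = (THE D. GDERIV f x :> D)"

definition hessian :: "(real^'n \<Rightarrow> real) \<Rightarrow> real^'n \<Rightarrow> real^'n^'n" where
  "hessian f x = jacobian (gradient f) (at x)"

text \<open>The differentiability conjuncts are needed because \<^const>\<open>gradient\<close> and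
  \<^const>\<open>hessian\<close> are total functions with arbitrary values where the derivatives do not exist.\<close>

definition twice_continuously_differentiable :: "(real^'n \<Rightarrow> real) \<Rightarrow> bool" where
  "twice_continuously_differentiable f \<longleftrightarrow>
    (\<forall>x. f differentiable at x) \<and>
    (\<forall>x. gradient f differentiable at x) \<and>
    continuous_on UNIV (hessian f)"

text \<open>Symmetry is not part of this definition. For the Hessian of a twice continuously
  differentiable function it is a theorem.\<close>

definition positive_definite :: "real^'n^'n \<Rightarrow> bool" where
  "positive_definite A \<longleftrightarrow> (\<forall>v. v \<noteq> 0 \<longrightarrow> 0 < v \<bullet> (A *v v))"

definition control_set ::
    "(real^'n \<Rightarrow> real) \<Rightarrow> (real^'n \<Rightarrow> real) \<Rightarrow> real^'n \<Rightarrow> (real^'n) set" where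
  "control_set E \<Delta> x = {u. u \<bullet> (hessian E x *v u) \<le> \<Delta> x}"

definition subdifferential :: "('a::real_inner \<Rightarrow> real) \<Rightarrow> 'a \<Rightarrow> 'a set" where
  "subdifferential V x = {\<xi>. \<forall>y. V x + \<xi> \<bullet> (y - x) \<le> V y}"

text \<open>The overloaded \<^const>\<open>sgn\<close> on \<^typ>\<open>real^'n\<close> normalizes a vector, so the componentwise
  sign needs its own definition. The overloaded product on \<^typ>\<open>real^'n\<close>, on the other hand,
  is the Hadamard product, and \<^const>\<open>infnorm\<close> is the maximum norm.\<close>

definition sign_vec :: "real^'n \<Rightarrow> real^'n" where
  "sign_vec v = (\<chi> i. sgn (v $ i))"

definition max_indicator :: "real^'n \<Rightarrow> real^'n" where
  "max_indicator v = (\<chi> i. if \<bar>v $ i\<bar> = Max (range (\<lambda>j. \<bar>v $ j\<bar>)) then 1 else 0)"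

definition is_unbiased_subgradient :: "real^'n \<Rightarrow> real^'n \<Rightarrow> bool" where
  "is_unbiased_subgradient v \<xi> \<longleftrightarrow>
    \<xi> \<in> subdifferential infnorm v \<and>
    (\<exists>\<gamma>>0. \<xi> = \<gamma> *\<^sub>R (max_indicator v * sign_vec v))"

lemma GDERIV_gradient:
  fixes f :: "'a::euclidean_space \<Rightarrow> real"
  assumes "f differentiable at x"
  shows "GDERIV f x :> gradient f x"
proof -
  obtain f' where f': "(f has_derivative f') (at x)"
    using assms by (auto simp: differentiable_def)
  define D where "D = (\<Sum>b\<in>Basis. f' b *\<^sub>R b)"
  have lin: "linear f'"
    using f' has_derivative_linear by blast
  have "f' h = h \<bullet> D" for h
  proof -
    have "f' h = f' (\<Sum>b\<in>Basis. (h \<bullet> b) *\<^sub>R b)"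
      by (simp add: euclidean_representation)
    also have "\<dots> = (\<Sum>b\<in>Basis. (h \<bullet> b) * f' b)"
      using lin by (simp add: linear_sum linear_scale)
    also have "\<dots> = h \<bullet> D"
      by (simp add: D_def inner_sum_right mult.commute)
    finally show ?thesis .
  qed
  then have "f' = (\<lambda>h. h \<bullet> D)"
    by auto
  with f' have D: "GDERIV f x :> D"
    by (simp add: gderiv_def)
  have "D' = D" if "GDERIV f x :> D'" for D'
  proof -
    have "(\<lambda>h. h \<bullet> D') = (\<lambda>h. h \<bullet> D)"
      using that D unfolding gderiv_def by (rule has_derivative_unique)
    then have "(D' - D) \<bullet> D' = (D' - D) \<bullet> D"
      by metis
    then have "(D' - D) \<bullet> (D' - D) = 0"
      by (simp only: inner_diff_right)
    then show ?thesis
      by simp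
  qed
  with D show ?thesis
    unfolding gradient_def by (metis theI)
qed

lemma infnorm_eq_Max_cart: "infnorm (v::real^'n) = Max (range (\<lambda>i. \<bar>v $ i\<bar>))"
  by (simp add: infnorm_cart cSup_eq_Max full_SetCompr_eq)

lemma unbiased_subgradient_iff:
  fixes v :: "real^'n"
  assumes "v \<noteq> 0"
  shows "is_unbiased_subgradient v \<xi> \<longleftrightarrow>
    \<xi> = (1 / card {i. \<bar>v $ i\<bar> = infnorm v}) *\<^sub>R (max_indicator v * sign_vec v)"
proof -
  define S where "S = {i. \<bar>v $ i\<bar> = infnorm v}"
  define p where "p = max_indicator v * sign_vec v"
  have p: "p $ i = (if i \<in> S then sgn (v $ i) else 0)" for i
    by (simp add: p_def max_indicator_def sign_vec_def S_def infnorm_eq_Max_cart)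
  have "infnorm v \<in> range (\<lambda>i. \<bar>v $ i\<bar>)"
    unfolding infnorm_eq_Max_cart by (rule Max_in) auto
  then have card: "card S > 0"
    by (auto simp: S_def card_gt_0_iff)
  have pos: "infnorm v > 0"
    using assms by (simp add: infnorm_pos_lt)
  have inner_p: "p \<bullet> y = (\<Sum>i\<in>S. sgn (v $ i) * y $ i)" for y
  proof -
    have "p \<bullet> y = (\<Sum>i\<in>UNIV. if i \<in> S then sgn (v $ i) * y $ i else 0)"
      by (auto simp: inner_vec_def p intro!: sum.cong)
    also have "\<dots> = (\<Sum>i\<in>S. sgn (v $ i) * y $ i)"
      by (simp add: sum.If_cases)
    finally show ?thesis .
  qed
  have pv: "p \<bullet> v = card S * infnorm v"
  proof -
    have "p \<bullet> v = (\<Sum>i\<in>S. infnorm v)"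
      unfolding inner_p by (rule sum.cong) (auto simp: S_def abs_sgn mult.commute)
    then show ?thesis by simp
  qed
  have le: "p \<bullet> y \<le> card S * infnorm y" for y
  proof -
    have "sgn (v $ i) * y $ i \<le> infnorm y" for i
      using component_le_infnorm_cart[of y i] infnorm_pos_le[of y] by (auto simp: sgn_if)
    then show ?thesis
      unfolding inner_p using sum_bounded_above[of S "\<lambda>i. sgn (v $ i) * y $ i" "infnorm y"] by simp
  qed
  have "(1 / card S) *\<^sub>R p \<in> subdifferential infnorm v"
    using le pv card by (auto simp: subdifferential_def inner_diff_right field_simps)
  moreover have "\<gamma> = 1 / card S" if "\<gamma> *\<^sub>R p \<in> subdifferential infnorm v" for \<gamma>
  proof -
    have sub: "infnorm v + \<gamma> *\<^sub>R p \<bullet> (y - v) \<le> infnorm y" for y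
      using that by (simp add: subdifferential_def)
    have "\<gamma> * (p \<bullet> v) = infnorm v"
      using sub[of 0] sub[of "2 *\<^sub>R v"]
      by (simp add: infnorm_0 infnorm_mul inner_diff_right algebra_simps)
    then have "\<gamma> * card S = 1"
      using pv pos by simp
    then show ?thesis
      using card by (auto simp: eq_divide_eq)
  qed
  moreover have "1 / real (card S) > 0"
    using card by simp
  ultimately show ?thesis
    unfolding is_unbiased_subgradient_def p_def[symmetric] S_def[symmetric] by blast
qed

end

theory Submission
  imports Defs
begin

text \<open>At a non-critical point put \<open>W\<close> for the Hessian and \<open>\<xi>\<close> for the unbiased subgradient, which
  is nonzero. The Hessian is symmetric and positive definite, so \<open>(v, w) \<mapsto> v \<bullet> W w\<close> is an inner
  product. The control set is a closed ball for its norm and the objective \<open>\<xi> \<bullet> W w\<close> is the inner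
  product with \<open>\<xi>\<close>. By the equality case of the Cauchy--Schwarz inequality, the only maximizer is
  the positive multiple of \<open>\<xi>\<close> on the boundary of the ball (\<open>arg_max_ellipsoid\<close>). Since \<open>\<xi>\<close> is a
  positive multiple of \<open>q \<circ> sign(\<lambda>)\<close> and \<open>\<lambda>\<close> is a negative multiple of the gradient, the Euler step
  is a coordinate descent step.

  Symmetry of \<open>W\<close> is indispensable: without it the maximizer is in general not parallel to \<open>\<xi>\<close>.
  It is derived here from the differentiability of the gradient (\<open>second_derivative_symmetric\<close>):
  both \<open>u \<bullet> W v\<close> and \<open>v \<bullet> W u\<close> are limits of the same second difference quotient.\<close>

text \<open>By the mean value theorem in the direction \<open>u\<close>, the second difference with increments \<open>t u\<close> and
  \<open>t v\<close> is \<open>t\<close> times the component along \<open>u\<close> of a difference of gradient values at points whose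
  displacement is \<open>t v\<close>. Differentiability of \<open>G\<close> at \<open>x\<close> alone makes this \<open>t\<^sup>2 (u \<bullet> H v) + o(t\<^sup>2)\<close>.\<close>

lemma second_difference_quotient_tendsto:
  fixes f :: "'a::real_inner \<Rightarrow> real"
  assumes grad: "\<And>y. GDERIV f y :> G y"
    and deriv: "(G has_derivative H) (at x)"
  shows "((\<lambda>t. (f (x + t *\<^sub>R u + t *\<^sub>R v) - f (x + t *\<^sub>R u) - f (x + t *\<^sub>R v) + f x) / t\<^sup>2)
    \<longlongrightarrow> u \<bullet> H v) (at_right 0)"
proof (rule tendstoI)
  fix \<epsilon> :: real
  assume "\<epsilon> > 0"
  define A where
    "A t = f (x + t *\<^sub>R u + t *\<^sub>R v) - f (x + t *\<^sub>R u) - f (x + t *\<^sub>R v) + f x" for t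
  define K where "K = norm u + norm v"
  \<comment> \<open>The error made below is at most \<open>2 e (norm u) K\<close>; adding 1 covers a zero coefficient.\<close>
  define e where "e = \<epsilon> / (2 * norm u * K + 1)"
  have K: "K \<ge> 0"
    by (simp add: K_def)
  have den: "2 * norm u * K + 1 > 0"
    using K by (simp add: add_nonneg_pos)
  then have e: "e > 0"
    using \<open>\<epsilon> > 0\<close> by (simp add: e_def)
  have "e * (2 * norm u * K + 1) = \<epsilon>"
    using den by (simp add: e_def)
  then have bound: "2 * e * norm u * K < \<epsilon>"
    using e by (simp add: algebra_simps)
  have linH: "linear H"
    using deriv by (rule has_derivative_linear)
  obtain d where d: "d > 0"
    and near: "\<And>w. norm w < d \<Longrightarrow> norm (G (x + w) - G x - H w) \<le> e * norm w"
  proof -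
    obtain d where "d > 0"
      and "\<And>y. norm (y - x) < d \<Longrightarrow> norm (G y - G x - H (y - x)) \<le> e * norm (y - x)"
      using deriv e unfolding has_derivative_at_alt by blast
    from this(1) this(2)[of "x + w" for w] show ?thesis
      by (intro that) auto
  qed
  have "dist (A t / t\<^sup>2) (u \<bullet> H v) < \<epsilon>" if t: "0 < t" "t < d / (K + 1)" for t
  proof -
    define \<phi> where "\<phi> r = f (x + (r * t) *\<^sub>R u + t *\<^sub>R v) - f (x + (r * t) *\<^sub>R u)" for r
    have f': "(f has_derivative (\<lambda>w. w \<bullet> G y)) (at y)" for y
      using grad[of y] by (simp add: gderiv_def)
    have line: "((\<lambda>r. f ((r * t) *\<^sub>R u + z)) has_real_derivative
        t * (u \<bullet> G ((r * t) *\<^sub>R u + z))) (at r)" for r z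
    proof -
      have "((\<lambda>r. (r * t) *\<^sub>R u + z) has_derivative (\<lambda>s. (s * t) *\<^sub>R u)) (at r)"
        by (auto intro!: derivative_eq_intros)
      from has_derivative_compose[OF this f'] show ?thesis
        by (simp add: has_field_derivative_def mult_commute_abs mult.assoc)
    qed
    have \<phi>': "(\<phi> has_real_derivative
        t * (u \<bullet> (G (x + (r * t) *\<^sub>R u + t *\<^sub>R v) - G (x + (r * t) *\<^sub>R u)))) (at r)" for r
      using DERIV_diff[OF line[of "x + t *\<^sub>R v" r] line[of x r]]
      by (simp add: \<phi>_def[abs_def] inner_diff_right right_diff_distrib add_ac)
    obtain r where r: "0 < r" "r < 1"
      and mv: "\<phi> 1 - \<phi> 0 =
        t * (u \<bullet> (G (x + (r * t) *\<^sub>R u + t *\<^sub>R v) - G (x + (r * t) *\<^sub>R u)))"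
      using MVT2[OF zero_less_one \<phi>'] by auto
    define a where "a = (r * t) *\<^sub>R u + t *\<^sub>R v"
    define b where "b = (r * t) *\<^sub>R u"
    have rt: "r * t \<le> t"
      using r t by simp
    have b_le: "norm b \<le> t * norm u"
      using r t rt by (simp add: b_def mult_right_mono)
    have "norm a \<le> norm b + t * norm v"
      unfolding a_def b_def using t by (intro norm_triangle_le) simp
    then have a_K: "norm a \<le> t * K"
      using b_le by (simp add: K_def distrib_left)
    have b_K: "norm b \<le> t * K"
      using b_le t by (simp add: K_def distrib_left add_increasing2)
    have "t * (K + 1) < d"
      using t K by (simp add: pos_less_divide_eq)
    then have "t * K < d"
      using t by (simp add: algebra_simps)
    then have "norm (G (x + a) - G x - H a) \<le> e * norm a"
        "norm (G (x + b) - G x - H b) \<le> e * norm b"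
      using a_K b_K by (auto intro!: near)
    then have na: "norm (G (x + a) - G x - H a) \<le> e * (t * K)"
      and nb: "norm (G (x + b) - G x - H b) \<le> e * (t * K)"
      using a_K b_K e by (meson mult_left_mono less_imp_le order_trans)+
    have "H a - H b = t *\<^sub>R H v"
      using linH by (simp add: a_def b_def linear_add linear_scale)
    then have "G (x + a) - G (x + b) - t *\<^sub>R H v
        = (G (x + a) - G x - H a) - (G (x + b) - G x - H b)"
      by (simp add: algebra_simps)
    then have "norm (G (x + a) - G (x + b) - t *\<^sub>R H v)
        \<le> norm (G (x + a) - G x - H a) + norm (G (x + b) - G x - H b)"
      by (simp only: norm_triangle_ineq4)
    then have nG: "norm (G (x + a) - G (x + b) - t *\<^sub>R H v) \<le> 2 * e * (t * K)"
      using na nb by simp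
    have "A t = t * (u \<bullet> (G (x + a) - G (x + b)))"
      using mv by (simp add: A_def \<phi>_def a_def b_def add.assoc)
    then have "A t - t\<^sup>2 * (u \<bullet> H v) = t * (u \<bullet> (G (x + a) - G (x + b) - t *\<^sub>R H v))"
      by (simp add: inner_diff_right power2_eq_square algebra_simps)
    then have "\<bar>A t - t\<^sup>2 * (u \<bullet> H v)\<bar> = t * \<bar>u \<bullet> (G (x + a) - G (x + b) - t *\<^sub>R H v)\<bar>"
      using t by (simp add: abs_mult)
    also have "\<dots> \<le> t * (norm u * (2 * e * (t * K)))"
      using t nG Cauchy_Schwarz_ineq2 by (meson mult_left_mono less_imp_le norm_ge_zero order_trans)
    also have "\<dots> = t\<^sup>2 * (2 * e * norm u * K)"
      by (simp add: power2_eq_square)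
    also have "\<dots> < t\<^sup>2 * \<epsilon>"
      using bound t by (intro mult_strict_left_mono) auto
    finally have "\<bar>A t - t\<^sup>2 * (u \<bullet> H v)\<bar> < t\<^sup>2 * \<epsilon>" .
    moreover have "A t / t\<^sup>2 - u \<bullet> H v = (A t - t\<^sup>2 * (u \<bullet> H v)) / t\<^sup>2"
      using t by (simp add: field_simps)
    ultimately show ?thesis
      using t by (simp add: dist_real_def pos_divide_less_eq mult.commute)
  qed
  moreover have "d / (K + 1) > 0"
    using d K by simp
  ultimately show "\<forall>\<^sub>F t in at_right 0. dist ((f (x + t *\<^sub>R u + t *\<^sub>R v) - f (x + t *\<^sub>R u)
      - f (x + t *\<^sub>R v) + f x) / t\<^sup>2) (u \<bullet> H v) < \<epsilon>"
    unfolding A_def eventually_at_right_field by blast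
qed

lemma second_derivative_symmetric:
  fixes f :: "'a::real_inner \<Rightarrow> real"
  assumes "\<And>y. GDERIV f y :> G y"
    and "(G has_derivative H) (at x)"
  shows "u \<bullet> H v = v \<bullet> H u"
proof (rule tendsto_unique)
  let ?Q = "\<lambda>t. (f (x + t *\<^sub>R u + t *\<^sub>R v) - f (x + t *\<^sub>R u) - f (x + t *\<^sub>R v) + f x) / t\<^sup>2"
  show "(?Q \<longlongrightarrow> u \<bullet> H v) (at_right 0)"
    using assms by (rule second_difference_quotient_tendsto)
  have "?Q = (\<lambda>t. (f (x + t *\<^sub>R v + t *\<^sub>R u) - f (x + t *\<^sub>R v) - f (x + t *\<^sub>R u) + f x) / t\<^sup>2)"
    by (simp add: fun_eq_iff algebra_simps)
  then show "(?Q \<longlongrightarrow> v \<bullet> H u) (at_right 0)"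
    using second_difference_quotient_tendsto[OF assms, of v u] by simp
qed simp

lemma hessian_symmetric:
  assumes "twice_continuously_differentiable E"
  shows "v \<bullet> (hessian E y *v w) = w \<bullet> (hessian E y *v v)"
proof (rule second_derivative_symmetric)
  show "GDERIV E z :> gradient E z" for z
    using assms by (auto simp: twice_continuously_differentiable_def intro: GDERIV_gradient)
  show "(gradient E has_derivative (*v) (hessian E y)) (at y)"
    using assms unfolding hessian_def twice_continuously_differentiable_def
    by (simp add: jacobian_works[symmetric])
qed

text \<open>A linear functional \<open>\<xi> \<bullet> W w\<close> has at most one maximizer on the ellipsoid \<open>w \<bullet> W w \<le> c\<close>, namely
  the multiple of \<open>\<xi>\<close> on its boundary. Expanding the square of the distance of a maximizer to this
  point in the norm of \<open>W\<close> shows that it is not positive.\<close>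

lemma arg_max_ellipsoid:
  fixes W :: "real^'n^'n"
  assumes sym: "\<And>v w. v \<bullet> (W *v w) = w \<bullet> (W *v v)"
    and pd: "positive_definite W"
    and "c > 0" "\<xi> \<noteq> 0"
    and max: "is_arg_max (\<lambda>w. \<xi> \<bullet> (W *v w)) (\<lambda>w. w \<bullet> (W *v w) \<le> c) u"
  shows "u = sqrt (c / (\<xi> \<bullet> (W *v \<xi>))) *\<^sub>R \<xi>"
proof -
  define a where "a = \<xi> \<bullet> (W *v \<xi>)"
  define s where "s = sqrt (c / a)"
  have a: "a > 0"
    using pd \<open>\<xi> \<noteq> 0\<close> by (simp add: a_def positive_definite_def)
  then have s: "s > 0" "s * s * a = c"
    using \<open>c > 0\<close> by (simp_all add: s_def)
  have W_s: "W *v (s *\<^sub>R \<xi>) = s *\<^sub>R (W *v \<xi>)"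
    by (simp add: matrix_vector_mult_scaleR)
  have "(s *\<^sub>R \<xi>) \<bullet> (W *v (s *\<^sub>R \<xi>)) \<le> c"
    using s by (simp add: W_s a_def mult.assoc)
  then have "\<xi> \<bullet> (W *v (s *\<^sub>R \<xi>)) \<le> \<xi> \<bullet> (W *v u)" and u: "u \<bullet> (W *v u) \<le> c"
    using max by (auto simp: is_arg_max_linorder)
  then have "s * (s * a) \<le> s * (\<xi> \<bullet> (W *v u))"
    using s by (simp add: W_s a_def)
  then have "c \<le> s * (\<xi> \<bullet> (W *v u))"
    using s(2) by (simp only: mult.assoc)
  moreover have "(u - s *\<^sub>R \<xi>) \<bullet> (W *v (u - s *\<^sub>R \<xi>))
      = u \<bullet> (W *v u) - 2 * (s * (\<xi> \<bullet> (W *v u))) + s * s * a"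
    by (simp add: matrix_vector_mult_diff_distrib W_s inner_diff_left inner_diff_right
        sym[of u \<xi>] a_def right_diff_distrib)
  ultimately have "\<not> (u - s *\<^sub>R \<xi>) \<bullet> (W *v (u - s *\<^sub>R \<xi>)) > 0"
    using u s by simp
  then have "u - s *\<^sub>R \<xi> = 0"
    using pd unfolding positive_definite_def by blast
  then show ?thesis
    by (simp add: s_def a_def)
qed

lemma unbiased_subgradient_nonzero:
  fixes v :: "real^'n"
  assumes "is_unbiased_subgradient v \<xi>" and "v \<noteq> 0"
  shows "\<xi> \<noteq> 0"
proof
  assume "\<xi> = 0"
  then have "infnorm v \<le> infnorm (0 :: real^'n)"
    using assms(1) by (simp add: is_unbiased_subgradient_def subdifferential_def)
  then show False
    using infnorm_pos_lt[of v] assms(2) by (simp add: infnorm_0)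
qed

lemma sign_vec_neg_scaleR:
  assumes "c > 0"
  shows "sign_vec (- (c *\<^sub>R v)) = - sign_vec v"
  using assms by (simp add: sign_vec_def vec_eq_iff sgn_mult sgn_minus)

theorem proposition4:
  fixes E :: "real^'n \<Rightarrow> real"
    and \<Delta> :: "real^'n \<Rightarrow> real"
    and \<nu>\<^sub>0 :: real
    and h :: "nat \<Rightarrow> real"
    and x u lam \<xi> :: "nat \<Rightarrow> real^'n"
  assumes "strictly_convex_on UNIV E"
    and "twice_continuously_differentiable E"
    and "\<And>y. positive_definite (hessian E y)"
    and "\<And>y. \<Delta> y > 0"
    and "\<nu>\<^sub>0 > 0"
    and "\<And>k. h k > 0"
    and "\<And>k. x (Suc k) = x k + h k *\<^sub>R u k"
    and "\<And>k. lam k = - (\<nu>\<^sub>0 *\<^sub>R gradient E (x k))"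
    and "\<And>k. gradient E (x k) \<noteq> 0 \<Longrightarrow> is_unbiased_subgradient (lam k) (\<xi> k)"
    and "\<And>k. gradient E (x k) \<noteq> 0 \<Longrightarrow>
      is_arg_max (\<lambda>w. \<xi> k \<bullet> (hessian E (x k) *v w)) (\<lambda>w. w \<in> control_set E \<Delta> (x k)) (u k)"
  shows "\<forall>k. gradient E (x k) \<noteq> 0 \<longrightarrow>
    (\<exists>\<alpha>>0. x (Suc k) = x k - \<alpha> *\<^sub>R (max_indicator (lam k) * sign_vec (gradient E (x k))))"
proof (intro allI impI)
  fix k
  assume nz: "gradient E (x k) \<noteq> 0"
  define W where "W = hessian E (x k)"
  define p where "p = max_indicator (lam k) * sign_vec (gradient E (x k))"
  define s where "s = sqrt (\<Delta> (x k) / (\<xi> k \<bullet> (W *v \<xi> k)))"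
  have sub: "is_unbiased_subgradient (lam k) (\<xi> k)"
    using assms(9) nz .
  then obtain \<gamma> where "\<gamma> > 0" and "\<xi> k = \<gamma> *\<^sub>R (max_indicator (lam k) * sign_vec (lam k))"
    by (auto simp: is_unbiased_subgradient_def)
  then have \<xi>: "\<xi> k = - (\<gamma> *\<^sub>R p)"
    by (simp add: assms(8) p_def sign_vec_neg_scaleR[OF assms(5)])
  have "lam k \<noteq> 0"
    using nz assms(5) by (simp add: assms(8))
  with sub have "\<xi> k \<noteq> 0"
    by (rule unbiased_subgradient_nonzero)
  have "u k = s *\<^sub>R \<xi> k"
    unfolding s_def
  proof (rule arg_max_ellipsoid)
    show "v \<bullet> (W *v w) = w \<bullet> (W *v v)" for v w
      unfolding W_def using assms(2) by (rule hessian_symmetric)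
    show "is_arg_max (\<lambda>w. \<xi> k \<bullet> (W *v w)) (\<lambda>w. w \<bullet> (W *v w) \<le> \<Delta> (x k)) (u k)"
      using assms(10)[OF nz] by (simp add: control_set_def W_def)
  qed (use assms(3,4) \<open>\<xi> k \<noteq> 0\<close> in \<open>auto simp: W_def\<close>)
  then have "x (Suc k) = x k - (h k * s * \<gamma>) *\<^sub>R p"
    by (simp add: assms(7) \<xi>)
  moreover have "s > 0"
    using assms(3)[of "x k"] assms(4)[of "x k"] \<open>\<xi> k \<noteq> 0\<close>
    by (simp add: s_def W_def positive_definite_def)
  then have "h k * s * \<gamma> > 0"
    using assms(6)[of k] \<open>\<gamma> > 0\<close> by simp
  ultimately show "\<exists>\<alpha>>0. x (Suc k)
      = x k - \<alpha> *\<^sub>R (max_indicator (lam k) * sign_vec (gradient E (x k)))"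
    unfolding p_def by blast
qed

end
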